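(* Let $\alpha>0$ and let $\Lambda\subset\mathbb{R}^3$ be a simply connected open domain contained in $\{x_2>0\}$. Let $h=h(x_0,x_1,x_2)$ be an $\alpha$-hyperbolic harmonic potential in $\Lambda$. Then $h$ is an $\alpha$-axial-hyperbolic harmonic potential in $\Lambda$ if and only if $$x_2\,\frac{\partial h}{\partial x_1}=x_1\,\frac{\partial h}{\partial x_2}\quad\text{in }\Lambda.$$
   Context: Here $\mathbb{R}^3=\{(x_0,x_1,x_2)\}$, $\Delta$ is the Euclidean Laplacian and $\rho=\sqrt{x_1^2+x_2^2}$. For $\alpha>0$, a real-valued $C^2$ function $h$ on a simply connected open domain $\Lambda\subset\{x_2>0\}$ is called an $\alpha$-hyperbolic harmonic potential in $\Lambda$ if it satisfies $x_2\Delta h-\alpha\,\frac{\partial h}{\partial x_2}=0$ in $\Lambda$. A real-valued $C^2$ function $h$ on a simply connected open domain $\Lambda\subset\{\rho>0\}$ is called an $\alpha$-axial-hyperbolic harmonic potential in $\Lambda$ if it satisfies $(x_1^2+x_2^2)\Delta h-\alpha\left(x_1\frac{\partial h}{\partial x_1}+x_2\frac{\partial h}{\partial x_2}\right)=0$ in $\Lambda$. *)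

theory Defs
  imports "HOL-Analysis.Analysis"
begin

(* Points of \<real>^3 are written (x_0, x_1, x_2) with x_k = x $ k. The index type 3 has exactly
   the elements 0, 1, 2 (its arithmetic is modulo 3, so the literal 3 denotes the index 0). *)

definition partial :: "'n::finite \<Rightarrow> (real^'n \<Rightarrow> real) \<Rightarrow> real^'n \<Rightarrow> real" where
  "partial i f x = deriv (\<lambda>t. f (x + t *\<^sub>R axis i 1)) 0"

(* The constant deriv is total, so existence of the partial derivatives has to be required. *)
definition C1_on :: "(real^'n::finite) set \<Rightarrow> (real^'n \<Rightarrow> real) \<Rightarrow> bool" where
  "C1_on S f \<longleftrightarrow> continuous_on S f \<and>
     (\<forall>i. (\<forall>x\<in>S. (\<lambda>t. f (x + t *\<^sub>R axis i 1)) field_differentiable (at 0)) \<and>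
          continuous_on S (partial i f))"

definition C2_on :: "(real^'n::finite) set \<Rightarrow> (real^'n \<Rightarrow> real) \<Rightarrow> bool" where
  "C2_on S f \<longleftrightarrow> C1_on S f \<and> (\<forall>i. C1_on S (partial i f))"

definition laplacian :: "(real^'n::finite \<Rightarrow> real) \<Rightarrow> real^'n \<Rightarrow> real" where
  "laplacian f x = (\<Sum>i\<in>UNIV. partial i (partial i f) x)"

(* Connectedness is part of the library's simply_connected. *)
definition simply_connected_domain :: "(real^3) set \<Rightarrow> bool" where
  "simply_connected_domain L \<longleftrightarrow> open L \<and> L \<noteq> {} \<and> simply_connected L"

definition rho :: "real^3 \<Rightarrow> real" where
  "rho x = sqrt ((x $ 1)\<^sup>2 + (x $ 2)\<^sup>2)"

(* Potentials are total functions; on the open set L the conditions below involve only their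
   values on L. *)
definition hyperbolic_harmonic_potential ::
    "real \<Rightarrow> (real^3) set \<Rightarrow> (real^3 \<Rightarrow> real) \<Rightarrow> bool" where
  "hyperbolic_harmonic_potential \<alpha> L h \<longleftrightarrow>
     simply_connected_domain L \<and> L \<subseteq> {x. x $ 2 > 0} \<and> C2_on L h \<and>
     (\<forall>x\<in>L. x $ 2 * laplacian h x - \<alpha> * partial 2 h x = 0)"

definition axial_hyperbolic_harmonic_potential ::
    "real \<Rightarrow> (real^3) set \<Rightarrow> (real^3 \<Rightarrow> real) \<Rightarrow> bool" where
  "axial_hyperbolic_harmonic_potential \<alpha> L h \<longleftrightarrow>
     simply_connected_domain L \<and> L \<subseteq> {x. rho x > 0} \<and> C2_on L h \<and>
     (\<forall>x\<in>L. ((x $ 1)\<^sup>2 + (x $ 2)\<^sup>2) * laplacian h x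
             - \<alpha> * (x $ 1 * partial 1 h x + x $ 2 * partial 2 h x) = 0)"

end

theory Submission
  imports Defs
begin

text \<open>
  Multiplying the axial equation by \<open>x\<^sub>2\<close> and eliminating the Laplacian with the hyperbolic
  equation leaves \<open>\<alpha> x\<^sub>1 (x\<^sub>1 \<partial>\<^sub>2h - x\<^sub>2 \<partial>\<^sub>1h) = 0\<close>. Off the plane \<open>x\<^sub>1 = 0\<close> this is the claim, and
  it extends to the plane because the first derivatives are continuous and the domain is open.
\<close>

text \<open>A point \<open>x\<close> of the hyperplane is the limit of
  \<open>x + t *\<^sub>R axis i 1\<close> as \<open>t\<close> tends to 0. For small
  \<open>t \<noteq> 0\<close> these points lie in the open set \<open>S\<close> but off the
  hyperplane, so continuity forces the value 0 at \<open>x\<close>.\<close>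

lemma continuous_zero_on_hyperplane:
  fixes g :: "real^'n::finite \<Rightarrow> real"
  assumes "open S" and "continuous_on S g"
    and zero: "\<And>y. y \<in> S \<Longrightarrow> y $ i \<noteq> 0 \<Longrightarrow> g y = 0"
    and "x \<in> S"
  shows "g x = 0"
proof (cases "x $ i = 0")
  case False
  then show ?thesis using zero \<open>x \<in> S\<close> by blast
next
  case True
  let ?p = "\<lambda>t. x + t *\<^sub>R axis i 1"
  have p: "(?p \<longlongrightarrow> x) (at 0)"
    by (auto intro!: tendsto_eq_intros)
  have "isCont g x"
    using assms continuous_on_eq_continuous_at by blast
  then have lim: "((\<lambda>t. g (?p t)) \<longlongrightarrow> g x) (at 0)"
    using p by (rule isCont_tendsto_compose)
  have "\<forall>\<^sub>F t in at 0. ?p t \<in> S"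
    using p \<open>open S\<close> \<open>x \<in> S\<close> by (rule topological_tendstoD)
  moreover have "\<forall>\<^sub>F t in at 0. t \<noteq> (0::real)"
    by (simp add: eventually_at_filter)
  \<comment> \<open>Since \<open>x $ i = 0\<close>, the coordinate \<open>?p t $ i\<close> is
    \<open>t\<close> itself, hence nonzero.\<close>
  ultimately have "\<forall>\<^sub>F t in at 0. g (?p t) = 0"
    by eventually_elim (use True in \<open>auto intro!: zero simp: axis_def\<close>)
  then have "((\<lambda>t. g (?p t)) \<longlongrightarrow> 0) (at 0)"
    by (rule tendsto_eventually)
  with lim show ?thesis
    by (rule tendsto_unique[rotated]) simp
qed

text \<open>Pointwise algebra: \<open>x\<close>, \<open>y\<close> stand for the coordinates 1 and 2,
  \<open>l\<close> for the Laplacian, and \<open>p\<close>, \<open>q\<close> for the partial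
  derivatives in directions 1 and 2. The alternative \<open>x = 0\<close> arises because the
  remainder carries the factor \<open>\<alpha> * x\<close>.\<close>

lemma axial_equation_iff:
  fixes \<alpha> x y l p q :: real
  assumes "\<alpha> \<noteq> 0" and "y \<noteq> 0" and hyp: "y * l - \<alpha> * q = 0"
  shows "(x\<^sup>2 + y\<^sup>2) * l - \<alpha> * (x * p + y * q) = 0 \<longleftrightarrow> x = 0 \<or> y * p = x * q"
proof -
  have "y * ((x\<^sup>2 + y\<^sup>2) * l - \<alpha> * (x * p + y * q))
      = (x\<^sup>2 + y\<^sup>2) * (y * l - \<alpha> * q) + \<alpha> * x * (x * q - y * p)"
    by (simp add: algebra_simps power2_eq_square)
  then have "y * ((x\<^sup>2 + y\<^sup>2) * l - \<alpha> * (x * p + y * q)) = \<alpha> * x * (x * q - y * p)"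
    using hyp by simp
  then show ?thesis
    using assms(1,2) by (metis eq_iff_diff_eq_0 mult_eq_0_iff)
qed

theorem proposition3p4:
  fixes \<alpha> :: real and \<Lambda> :: "(real^3) set" and h :: "real^3 \<Rightarrow> real"
  assumes "\<alpha> > 0"
    and "simply_connected_domain \<Lambda>"
    and "\<Lambda> \<subseteq> {x. x $ 2 > 0}"
    and "hyperbolic_harmonic_potential \<alpha> \<Lambda> h"
  shows "axial_hyperbolic_harmonic_potential \<alpha> \<Lambda> h \<longleftrightarrow>
    (\<forall>x\<in>\<Lambda>. x $ 2 * partial 1 h x = x $ 1 * partial 2 h x)"
proof -
  have C2: "C2_on \<Lambda> h"
    and hyp: "\<And>x. x \<in> \<Lambda> \<Longrightarrow> x $ 2 * laplacian h x - \<alpha> * partial 2 h x = 0"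
    using assms(4) by (auto simp: hyperbolic_harmonic_potential_def)
  have pos: "x $ 2 > 0" if "x \<in> \<Lambda>" for x
    using that assms(3) by blast
  have rho: "\<Lambda> \<subseteq> {x. rho x > 0}"
    using pos by (force simp: rho_def intro!: add_nonneg_pos)
  have cont: "continuous_on \<Lambda> (\<lambda>x. x $ 2 * partial 1 h x - x $ 1 * partial 2 h x)"
    using C2 by (auto simp: C2_on_def C1_on_def intro!: continuous_intros)
  have "axial_hyperbolic_harmonic_potential \<alpha> \<Lambda> h \<longleftrightarrow>
      (\<forall>x\<in>\<Lambda>. x $ 1 = 0 \<or> x $ 2 * partial 1 h x = x $ 1 * partial 2 h x)"
    using axial_equation_iff[OF _ _ hyp] pos assms(1,2) rho C2
    by (force simp: axial_hyperbolic_harmonic_potential_def)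
  \<comment> \<open>The difference of the two sides is continuous on \<Lambda> and vanishes wherever
    \<open>x $ 1 \<noteq> 0\<close>, hence also on the plane \<open>x $ 1 = 0\<close>.\<close>
  also have "\<dots> \<longleftrightarrow> (\<forall>x\<in>\<Lambda>. x $ 2 * partial 1 h x = x $ 1 * partial 2 h x)"
    using continuous_zero_on_hyperplane[OF _ cont, where i = 1] assms(2)
    by (fastforce simp: simply_connected_domain_def)
  finally show ?thesis .
qed

end
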